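(* Let $G$ be a one-step $W$-groupoid and let $e,f\in G$ with $e\neq f$, $ef\neq fe$ and $G=\langle e,f\rangle$. If $\|e\|=3$, then $G$ is one of the following two quasigroups (in each table the entry in row $x$ and column $y$ is the product $xy$, and the elements labelling the rows are distinct and are all the elements of $G$). (1) If $e=(fef)f$, then $G$ has the following Cayley table: $$\begin{array}{c|ccccc} & e & f & ef & fe & fef\\ \hline e & e & ef & f & fef & fe\\ f & fe & f & fef & e & ef\\ ef & fef & fe & ef & f & e\\ fe & ef & fef & e & fe & f\\ fef & f & e & fe & ef & fef \end{array}$$ (2) If $e=f(fef)$, then $G$ has the following Cayley table, where $$(1,2,3,4,5,6,7,8,9,10,11)=(e,\ ef,\ fe,\ fef,\ f(fe),\ e(ef),\ efe,\ (ef)(fe),\ (fe)(ef),\ e(f(fe)),\ e(efe)):$$ $$\begin{array}{c|ccccccccccc} & 1&2&3&4&5&6&7&8&9&10&11\\ \hline 1 & 1&6&7&5&10&3&11&9&4&8&2\\ 2 & 7&2&8&9&1&5&10&4&11&6&3\\ 3 & 2&9&3&10&6&11&8&1&7&5&4\\ 4 & 8&3&6&4&7&9&1&11&10&2&5\\ 5 & 9&10&4&8&5&7&3&6&2&11&1\\ 6 & 11&7&10&2&4&6&9&3&5&1&8\\ 7 & 6&5&2&11&8&4&7&10&1&3&9\\ 8 & 5&11&9&7&3&1&2&8&6&4&10\\ 9 & 10&8&1&3&11&2&4&5&9&7&6\\ 10 & 4&1&11&6&9&8&5&2&3&10&7\\ 11 & 3&4&5&1&2&10&6&7&8&9&11 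\end{array}$$
   Context: A groupoid is a set with a binary operation, written by juxtaposition. $W$ is the variety of idempotent right modular groupoids, i.e. groupoids satisfying $xx=x$ and $(xy)z=(zy)x$ for all $x,y,z$. Every groupoid in $W$ satisfies $(xy)x=x(yx)$, and $xyx$ denotes this common value. A one-step $W$-groupoid is a non-commutative groupoid $G\in W$ (finite or infinite) such that every proper subgroupoid of $G$ is commutative. $\langle x,y\rangle$ denotes the subgroupoid generated by $x$ and $y$. In the situation of the claim, put $g=ef$; then it is known that $G=\langle f,g\rangle$. A word is a finite product of terms, each equal to $f$ or to $g=ef$, bracketed in any meaningful manner; its length is the number of such terms (counted with repetition, each occurrence of $f$ or of $ef$ counting as one term). For $x\in G$, $\|x\|$ denotes the minimum length of a word representing $x$. The number $\|e\|$ is called the dimension of $G$. *)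

theory Defs
  imports Main
begin

locale groupoid =
  fixes carrier :: "'a set" and mult :: "'a \<Rightarrow> 'a \<Rightarrow> 'a" (infixl "\<cdot>" 70)
  assumes closed: "x \<in> carrier \<Longrightarrow> y \<in> carrier \<Longrightarrow> x \<cdot> y \<in> carrier"

locale W_groupoid = groupoid +
  assumes idem: "x \<in> carrier \<Longrightarrow> x \<cdot> x = x"
    and right_modular:
      "x \<in> carrier \<Longrightarrow> y \<in> carrier \<Longrightarrow> z \<in> carrier \<Longrightarrow> (x \<cdot> y) \<cdot> z = (z \<cdot> y) \<cdot> x"

definition subgroupoid :: "'a set \<Rightarrow> 'a set \<Rightarrow> ('a \<Rightarrow> 'a \<Rightarrow> 'a) \<Rightarrow> bool" where
  "subgroupoid H G m \<longleftrightarrow> H \<subseteq> G \<and> groupoid H m"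

definition commutative_on :: "'a set \<Rightarrow> ('a \<Rightarrow> 'a \<Rightarrow> 'a) \<Rightarrow> bool" where
  "commutative_on H m \<longleftrightarrow> (\<forall>x\<in>H. \<forall>y\<in>H. m x y = m y x)"

locale one_step_W_groupoid = W_groupoid +
  assumes noncommutative: "\<not> commutative_on carrier mult"
    and proper_commutative:
      "subgroupoid H carrier mult \<Longrightarrow> H \<noteq> carrier \<Longrightarrow> commutative_on H mult"

definition generated_subgroupoid :: "'a set \<Rightarrow> ('a \<Rightarrow> 'a \<Rightarrow> 'a) \<Rightarrow> 'a set \<Rightarrow> 'a set" where
  "generated_subgroupoid G m S = \<Inter>{H. subgroupoid H G m \<and> S \<subseteq> H}"

locale quasigroup = groupoid +
  assumes left_division: "a \<in> carrier \<Longrightarrow> b \<in> carrier \<Longrightarrow> \<exists>!x. x \<in> carrier \<and> a \<cdot> x = b"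
    and right_division: "a \<in> carrier \<Longrightarrow> b \<in> carrier \<Longrightarrow> \<exists>!y. y \<in> carrier \<and> y \<cdot> a = b"

text \<open>Bracketed words in two letters; the letters \<open>F\<close> and \<open>EF\<close> stand for the terms
  \<open>f\<close> and \<open>g = ef\<close>, each of length one.\<close>

datatype gword = F | EF | Prod gword gword

fun word_length :: "gword \<Rightarrow> nat" where
  "word_length F = 1"
| "word_length EF = 1"
| "word_length (Prod u v) = word_length u + word_length v"

fun word_value :: "('a \<Rightarrow> 'a \<Rightarrow> 'a) \<Rightarrow> 'a \<Rightarrow> 'a \<Rightarrow> gword \<Rightarrow> 'a" where
  "word_value m e f F = f"
| "word_value m e f EF = m e f"
| "word_value m e f (Prod u v) = m (word_value m e f u) (word_value m e f v)"

text \<open>The least element below is meaningful when \<open>x\<close> is represented by some word,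
  i.e. lies in the subgroupoid generated by \<open>f\<close> and \<open>ef\<close>; for a one-step
  \<open>W\<close>-groupoid generated by non-commuting \<open>e\<close>, \<open>f\<close> this is every element.\<close>

definition word_norm :: "('a \<Rightarrow> 'a \<Rightarrow> 'a) \<Rightarrow> 'a \<Rightarrow> 'a \<Rightarrow> 'a \<Rightarrow> nat" where
  "word_norm m e f x = (LEAST n. \<exists>w. word_value m e f w = x \<and> word_length w = n)"

text \<open>\<open>xs\<close> lists the row and column labels in order; \<open>T\<close> is the list of rows of entries.\<close>

definition has_cayley_table ::
  "'a set \<Rightarrow> ('a \<Rightarrow> 'a \<Rightarrow> 'a) \<Rightarrow> 'a list \<Rightarrow> 'a list list \<Rightarrow> bool" where
  "has_cayley_table G m xs T \<longleftrightarrow>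
     distinct xs \<and> set xs = G \<and> map (\<lambda>x. map (\<lambda>y. m x y) xs) xs = T"

text \<open>Replaces each position, counted from 1, in a numbered table by the label at that position.\<close>

definition labelled :: "'a list \<Rightarrow> nat list list \<Rightarrow> 'a list list" where
  "labelled xs N = map (map (\<lambda>k. xs ! (k - 1))) N"

end

theory Submission
  imports Defs "HOL-Number_Theory.Cong"
begin

text \<open>
  Over a field with \<open>a\<^sup>2 + a = 1\<close> the operation \<open>x\<cdot>y = ax + (1 - a)y\<close> is idempotent
  and right modular. With \<open>f = 0\<close>, \<open>e = 1\<close> the equation \<open>e = (fef)f\<close> reads \<open>a\<^sup>4 = 1\<close>, which forces
  the field of order 5 and \<open>a = 2\<close>, while \<open>e = f(fef)\<close> reads \<open>a\<^sup>5 = 1\<close>, which forces the field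
  of order 11 and \<open>a = 3\<close>. In an arbitrary \<open>W\<close>-groupoid each of the two equations makes the
  words that contain \<open>e\<close> a homomorphic image of this affine structure over
  \<open>\<int>/5\<close> or \<open>\<int>/11\<close>. A non-injective image is a single point, which \<open>ef \<noteq> fe\<close> excludes; an injective
  image is not commutative and hence is all of \<open>G\<close>.

  With \<open>g = ef\<close>, a word of length 3 that is not equal to a shorter one represents one of
  \<open>f(fg)\<close>, \<open>fgf\<close>, \<open>gfg\<close>, \<open>g(gf)\<close>. The first two give the two cases, and \<open>e = gfg\<close> implies \<open>e = fgf\<close>.
  If \<open>e = g(gf)\<close>, then \<open>e\<close> and \<open>f(fe)\<close> generate an image of the affine structure over the field of
  order 4; if they do not commute, this is all of \<open>G\<close> and \<open>e = fef\<close> has norm at most 2, and if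
  they do, then \<open>e = fgf\<close> again.
\<close>

section \<open>Idempotent right modular operations\<close>

text \<open>Being total on the type, these laws let proof search ignore membership;
  \<open>total_extension\<close> carries the results back to a carrier.\<close>

locale idem_right_modular =
  fixes mult :: "'a \<Rightarrow> 'a \<Rightarrow> 'a" (infixl "\<cdot>" 70)
  assumes idem: "x \<cdot> x = x"
    and right_modular: "(x \<cdot> y) \<cdot> z = (z \<cdot> y) \<cdot> x"
begin

text \<open>As \<open>(xy)y = (yy)x\<close>, left multiplication by \<open>y\<close> is right
  multiplication by \<open>y\<close> done twice; in the affine model this is
  \<open>1 - a = a^2\<close>.\<close>

lemma mult_mult_right: "(x \<cdot> y) \<cdot> y = y \<cdot> x"
  by (metis idem right_modular)

lemma flexible: "x \<cdot> (y \<cdot> x) = (x \<cdot> y) \<cdot> x"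
  by (metis mult_mult_right)

text \<open>Three right modular steps:
  \<open>(xy)(zw) = ((zw)y)x = ((yw)z)x = (xz)(yw)\<close>.\<close>

lemma medial: "(x \<cdot> y) \<cdot> (z \<cdot> w) = (x \<cdot> z) \<cdot> (y \<cdot> w)"
  by (metis right_modular)

lemma right_distrib: "(x \<cdot> y) \<cdot> z = (x \<cdot> z) \<cdot> (y \<cdot> z)"
  by (metis idem medial)

lemma left_distrib: "x \<cdot> (y \<cdot> z) = (x \<cdot> y) \<cdot> (x \<cdot> z)"
  by (metis idem medial)

lemmas identities = idem right_modular mult_mult_right flexible medial right_distrib left_distrib

text \<open>Because \<open>f(ef) = (fe)f\<close> and \<open>(ef)f = fe\<close>, it follows that
  \<open>f\<close> and \<open>g = ef\<close> cannot commute unless \<open>e\<close> and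
  \<open>f\<close> do.\<close>

lemma commute_if_fef_eq_fe: "(f \<cdot> e) \<cdot> f = f \<cdot> e \<Longrightarrow> e \<cdot> f = f \<cdot> e"
  by (metis idem right_modular mult_mult_right flexible)

text \<open>In the affine model \<open>e = gfg\<close> reads \<open>2a^3 = 1\<close>, that is
  \<open>4a = 3\<close>; with \<open>a^2 + a = 1\<close> this gives \<open>5 = 0\<close> and
  \<open>a = 2\<close>, so \<open>a^4 = 1\<close>.\<close>

lemma gfg_imp_fgf:
  assumes "e = (f \<cdot> e) \<cdot> (e \<cdot> f)"
  shows "e = ((f \<cdot> e) \<cdot> f) \<cdot> f"
  using assms identities by metis

text \<open>In the affine model \<open>e = g(gf)\<close> reads \<open>a^2 + a^4 = 1\<close> and
  forces \<open>2 = 0\<close>, as in the field of order 4. The conclusions relate \<open>e\<close>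
  and \<open>y\<close> without mentioning \<open>f\<close>.\<close>

lemma ggf_imp_quaternary:
  assumes "e = (e \<cdot> f) \<cdot> (f \<cdot> e)" and "y = f \<cdot> (f \<cdot> e)"
  shows "e = (y \<cdot> e) \<cdot> y" and "y = (e \<cdot> y) \<cdot> e"
  using assms identities by metis+

text \<open>If \<open>ey = ye\<close>, the table of \<open>quaternary_table\<close> collapses to
  \<open>y = e\<close>, and \<open>f(fe) = ((fe)f)f\<close>.\<close>

lemma ggf_imp_fgf_if_commute:
  assumes "e = (e \<cdot> f) \<cdot> (f \<cdot> e)" and "y = f \<cdot> (f \<cdot> e)" and "e \<cdot> y = y \<cdot> e"
  shows "e = ((f \<cdot> e) \<cdot> f) \<cdot> f"
  using assms identities by metis

text \<open>The affine table over the field of order 4 with \<open>e = 1\<close>,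
  \<open>y = a\<close>, \<open>u = a^2\<close>, \<open>v = 0\<close>; the four elements may
  coincide.\<close>

lemma quaternary_table:
  assumes "e = (y \<cdot> e) \<cdot> y" and "y = (e \<cdot> y) \<cdot> e" and "u = e \<cdot> y" and "v = y \<cdot> e"
  shows "e \<cdot> u = v" "e \<cdot> v = y" "y \<cdot> u = e" "y \<cdot> v = u" "u \<cdot> e = y"
    "u \<cdot> y = v" "u \<cdot> v = e" "v \<cdot> e = u" "v \<cdot> y = e" "v \<cdot> u = y"
  using assms identities by metis+

end

section \<open>Affine images of residue rings\<close>

text \<open>A possibly non-injective homomorphism from the residues mod \<open>p\<close> under
  \<open>ax + (1 - a)y\<close>, kept as a \<open>p\<close>-periodic function on the
  integers.\<close>

definition affine_hom :: "('a \<Rightarrow> 'a \<Rightarrow> 'a) \<Rightarrow> int \<Rightarrow> int \<Rightarrow> (int \<Rightarrow> 'a) \<Rightarrow> bool" where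
  "affine_hom m p a \<phi> \<longleftrightarrow>
     (\<forall>x y. m (\<phi> x) (\<phi> y) = \<phi> (a * x + (1 - a) * y)) \<and> (\<forall>n. \<phi> (n mod p) = \<phi> n)"

lemma affine_hom_mult: "affine_hom m p a \<phi> \<Longrightarrow> m (\<phi> x) (\<phi> y) = \<phi> (a * x + (1 - a) * y)"
  by (simp add: affine_hom_def)

lemma affine_hom_cong: "affine_hom m p a \<phi> \<Longrightarrow> [x = y] (mod p) \<Longrightarrow> \<phi> x = \<phi> y"
  unfolding affine_hom_def cong_def by metis

text \<open>A table indexed by \<open>0, ..., p - 1\<close> extends periodically, since reduction
  mod \<open>p\<close> respects the affine expression.\<close>

lemma affine_hom_nth:
  fixes a :: int
  assumes "0 < p"
    and table: "\<And>i j. i \<in> {..<p} \<Longrightarrow> j \<in> {..<p} \<Longrightarrow>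
      m (c ! i) (c ! j) = c ! nat ((a * int i + (1 - a) * int j) mod int p)"
  shows "affine_hom m (int p) a (\<lambda>n. c ! nat (n mod int p))"
proof -
  have "m (c ! nat (x mod int p)) (c ! nat (y mod int p))
      = c ! nat ((a * x + (1 - a) * y) mod int p)" for x y
  proof -
    have "nat (x mod int p) \<in> {..<p}" "nat (y mod int p) \<in> {..<p}"
      using \<open>0 < p\<close> by (auto simp: nat_less_iff)
    moreover have "(a * (x mod int p) + (1 - a) * (y mod int p)) mod int p
        = (a * x + (1 - a) * y) mod int p"
      by (intro mod_add_cong) (simp_all add: mod_mult_right_eq)
    ultimately show ?thesis
      using \<open>0 < p\<close> by (simp add: table)
  qed
  then show ?thesis by (simp add: affine_hom_def)
qed

lemma prime_cong_solve:
  fixes p :: int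
  assumes "prime p" and "\<not> p dvd a"
  obtains k where "[a * k = b] (mod p)"
proof -
  have "coprime a p"
    using assms prime_imp_coprime coprime_commute by blast
  then obtain k where "[a * k = 1] (mod p)"
    using cong_solve_coprime_int by blast
  then have "[a * k * b = 1 * b] (mod p)"
    by (rule cong_scalar_right)
  then have "[a * (k * b) = b] (mod p)" by (simp add: mult.assoc)
  then show thesis by (rule that)
qed

text \<open>One collision gives the period \<open>d = a(j - i)\<close>: as \<open>1 - a\<close> is a
  unit, every \<open>t\<close> is \<open>ai + (1 - a)c\<close> modulo \<open>p\<close>, and
  replacing \<open>i\<close> by \<open>j\<close> shifts it by \<open>d\<close>. As \<open>d\<close>
  is a unit too, its multiples reach every residue.\<close>

lemma affine_hom_constant:
  fixes p :: int
  assumes hom: "affine_hom m p a \<phi>" and "prime p" and "\<not> p dvd a" and "\<not> p dvd 1 - a"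
    and eq: "\<phi> i = \<phi> j" and "\<not> [i = j] (mod p)"
  shows "\<phi> x = \<phi> y"
proof -
  define d where "d = a * (j - i)"
  have period: "\<phi> (t + d) = \<phi> t" for t
  proof -
    obtain c where c: "[(1 - a) * c = t - a * i] (mod p)"
      using prime_cong_solve assms by blast
    have "\<phi> (t + d) = \<phi> (a * j + (1 - a) * c)"
      using cong_add[OF cong_refl c, of "a * j"]
      by (intro affine_hom_cong[OF hom]) (simp add: d_def algebra_simps cong_sym_eq)
    also have "\<dots> = \<phi> (a * i + (1 - a) * c)"
      using affine_hom_mult[OF hom] eq by metis
    also have "\<dots> = \<phi> t"
      using cong_add[OF cong_refl c, of "a * i"] by (intro affine_hom_cong[OF hom]) simp
    finally show ?thesis .
  qed
  have "\<not> p dvd d"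
    using assms by (auto simp: d_def prime_dvd_mult_iff cong_iff_dvd_diff dvd_diff_commute)
  then obtain k where k: "[d * k = y - x] (mod p)"
    using prime_cong_solve \<open>prime p\<close> by blast
  have "p > 0" using \<open>prime p\<close> by (simp add: prime_gt_0_int)
  have periods: "\<phi> (t + d * int n) = \<phi> t" for t n
  proof (induction n)
    case (Suc n)
    then show ?case using period[of "t + d * int n"] by (simp add: algebra_simps)
  qed simp
  \<comment> \<open>The residue of \<open>k\<close> is nonnegative, as the induction over natural
    multiples of \<open>d\<close> requires.\<close>
  have "[x + d * int (nat (k mod p)) = x + (y - x)] (mod p)"
    using k \<open>p > 0\<close> by (intro cong_add) (auto simp: cong_def mod_mult_right_eq)
  then have "\<phi> (x + d * int (nat (k mod p))) = \<phi> y"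
    using affine_hom_cong[OF hom] by fastforce
  then show ?thesis by (simp only: periods)
qed

section \<open>One-step groupoids filled by an affine image\<close>

context one_step_W_groupoid
begin

text \<open>Two distinct values rule out a constant image, so \<open>\<phi>\<close> is injective on
  residues and its range is a noncommutative subgroupoid, hence the carrier. Table and division are
  then those of the affine operation.\<close>

lemma affine_hom_bij:
  fixes p :: int
  assumes hom: "affine_hom (\<cdot>) p a \<phi>" and range: "range \<phi> \<subseteq> carrier"
    and p: "prime p" "\<not> p dvd a" "\<not> p dvd 1 - a" "\<not> p dvd 2 * a - 1"
    and "\<phi> i \<noteq> \<phi> j"
  shows affine_hom_range: "range \<phi> = carrier"
    and affine_hom_eq_iff: "\<phi> x = \<phi> y \<longleftrightarrow> [x = y] (mod p)"
    and affine_hom_quasigroup: "quasigroup carrier (\<cdot>)"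
    and affine_hom_cayley: "distinct ks \<Longrightarrow> set ks = {0..<p} \<Longrightarrow>
      has_cayley_table carrier (\<cdot>) (map \<phi> ks)
        (map (\<lambda>x. map (\<lambda>y. \<phi> ((a * x + (1 - a) * y) mod p)) ks) ks)"
proof -
  note [simp] = affine_hom_mult[OF hom]
  show eq_iff: "\<phi> x = \<phi> y \<longleftrightarrow> [x = y] (mod p)" for x y
    using affine_hom_constant[OF hom p(1-3)] affine_hom_cong[OF hom] \<open>\<phi> i \<noteq> \<phi> j\<close> by metis
  have "subgroupoid (range \<phi>) carrier (\<cdot>)"
    using range by (auto simp: subgroupoid_def groupoid_def)
  \<comment> \<open>The products are \<open>\<phi> a\<close> and \<open>\<phi> (1 - a)\<close>,
    whose arguments differ by \<open>2 * a - 1\<close>.\<close>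
  moreover have "\<phi> 1 \<cdot> \<phi> 0 \<noteq> \<phi> 0 \<cdot> \<phi> 1"
    using p(4) by (simp add: eq_iff cong_iff_dvd_diff)
  then have "\<not> commutative_on (range \<phi>) (\<cdot>)"
    unfolding commutative_on_def by blast
  ultimately show surj: "range \<phi> = carrier"
    using proper_commutative by blast
  have mod: "\<phi> (n mod p) = \<phi> n" for n
    using hom by (simp add: affine_hom_def)
  show "has_cayley_table carrier (\<cdot>) (map \<phi> ks)
      (map (\<lambda>x. map (\<lambda>y. \<phi> ((a * x + (1 - a) * y) mod p)) ks) ks)"
    if ks: "distinct ks" "set ks = {0..<p}"
  proof -
    have "inj_on \<phi> {0..<p}" by (auto simp: inj_on_def eq_iff cong_def)
    moreover have "\<phi> n \<in> \<phi> ` {0..<p}" for n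
      using p(1) mod[of n] imageI[of "n mod p" "{0..<p}" \<phi>] by (simp add: prime_gt_0_int)
    then have "\<phi> ` {0..<p} = carrier"
      unfolding surj[symmetric] by blast
    ultimately show ?thesis
      using ks by (simp add: has_cayley_table_def distinct_map mod)
  qed
  have cancel: "[c * x = c * y] (mod p) \<longleftrightarrow> [x = y] (mod p)" if "\<not> p dvd c" for c x y
    using that p(1) prime_imp_coprime coprime_commute cong_mult_lcancel by blast
  show "quasigroup carrier (\<cdot>)"
  proof
    fix u v assume "u \<in> carrier" "v \<in> carrier"
    then obtain x y where u: "u = \<phi> x" and v: "v = \<phi> y" using surj by blast
    obtain k where k: "[(1 - a) * k = y - a * x] (mod p)"
      using prime_cong_solve p by blast
    obtain l where l: "[a * l = y - (1 - a) * x] (mod p)"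
      using prime_cong_solve p by blast
    show "\<exists>!w. w \<in> carrier \<and> u \<cdot> w = v"
    proof (rule ex1I)
      show "\<phi> k \<in> carrier \<and> u \<cdot> \<phi> k = v"
        using range cong_add[OF cong_refl k, of "a * x"] by (auto simp: u v eq_iff)
      fix w assume w: "w \<in> carrier \<and> u \<cdot> w = v"
      then obtain z where z: "w = \<phi> z" using surj by blast
      have "[a * x + (1 - a) * z = a * x + (1 - a) * k] (mod p)"
        using w cong_add[OF cong_refl k, of "a * x"]
        by (auto simp: u v z eq_iff intro: cong_trans cong_sym)
      then show "w = \<phi> k" using p by (simp add: z eq_iff cong_add_lcancel cancel)
    qed
    show "\<exists>!w. w \<in> carrier \<and> w \<cdot> u = v"
    proof (rule ex1I)
      show "\<phi> l \<in> carrier \<and> \<phi> l \<cdot> u = v"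
        using range cong_add[OF l cong_refl, of "(1 - a) * x"] by (auto simp: u v eq_iff)
      fix w assume w: "w \<in> carrier \<and> w \<cdot> u = v"
      then obtain z where z: "w = \<phi> z" using surj by blast
      have "[a * z + (1 - a) * x = a * l + (1 - a) * x] (mod p)"
        using w cong_add[OF l cong_refl, of "(1 - a) * x"]
        by (auto simp: u v z eq_iff intro: cong_trans cong_sym)
      then show "w = \<phi> l" using p by (simp add: z eq_iff cong_add_rcancel cancel)
    qed
  qed
qed

end

section \<open>The two equations and their multiplication tables\<close>

context idem_right_modular
begin

text \<open>Entry \<open>n\<close> is a word with affine coordinate \<open>n\<close> for
  \<open>f = 0\<close>, \<open>e = 1\<close>, \<open>a = 2\<close>. Coordinate 0 is given to
  \<open>e(ef)\<close>, since \<open>f\<close> itself need not lie in the image.\<close>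

lemma affine_hom_5:
  assumes "e = ((f \<cdot> e) \<cdot> f) \<cdot> f"
  shows "affine_hom (\<cdot>) 5 2
    (\<lambda>n. [e \<cdot> (e \<cdot> f), e, e \<cdot> f, (f \<cdot> e) \<cdot> f, f \<cdot> e] ! nat (n mod 5))"
proof -
  define c0 c1 c2 c3 c4
    where c: "c0 = e \<cdot> (e \<cdot> f)" "c1 = e" "c2 = e \<cdot> f" "c3 = (f \<cdot> e) \<cdot> f" "c4 = f \<cdot> e"
  \<comment> \<open>Right multiplication by \<open>f\<close> doubles the index modulo 5; the
    hypothesis closes the cycle \<open>1, 2, 4, 3, 1\<close>.\<close>
  have right: "c1 \<cdot> f = c2" "c2 \<cdot> f = c4" "c4 \<cdot> f = c3" "c3 \<cdot> f = c1" "c1 \<cdot> c2 = c0"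
    using assms by (simp_all add: c mult_mult_right)
  then have left: "f \<cdot> c1 = c4" "f \<cdot> c2 = c3" "f \<cdot> c3 = c2" "f \<cdot> c4 = c1"
    by (metis mult_mult_right)+
  note t0 = right left idem
  \<comment> \<open>Each instance of \<open>(xy)z = (zy)x\<close> has both inner products and one
    outer product known from earlier layers, so it supplies the other outer product.\<close>
  have t1: "c2 \<cdot> c3 = c1" "c4 \<cdot> c1 = c2" "c4 \<cdot> c3 = c0" "c1 \<cdot> c4 = c3"
      "c3 \<cdot> c2 = c4"
    using right_modular[of c1 f c3] right_modular[of c2 f c1] right_modular[of c2 f c3]
      right_modular[of c3 f c4] right_modular[of c4 f c2]
    by (simp_all only: t0)
  have t2: "c0 \<cdot> c3 = c2" "c3 \<cdot> c4 = c2" "c1 \<cdot> c3 = c4" "c4 \<cdot> c2 = c1"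
      "c2 \<cdot> c1 = c3" "c0 \<cdot> c2 = c3"
    using right_modular[of c1 c2 c3] right_modular[of c1 c4 c4] right_modular[of c2 c3 c3]
      right_modular[of c3 c2 c2] right_modular[of c4 c1 c1] right_modular[of c4 c3 c2]
    by (simp_all only: t0 t1)
  have t3: "c3 \<cdot> c1 = c0" "c2 \<cdot> c4 = c0" "c0 \<cdot> c4 = c1" "c4 \<cdot> c0 = c3"
      "c2 \<cdot> c0 = c4" "c1 \<cdot> c0 = c2" "c3 \<cdot> c0 = c1" "c0 \<cdot> c1 = c4"
    using right_modular[of c0 c2 c1] right_modular[of c0 c3 c4] right_modular[of c1 c2 c4]
      right_modular[of c1 c3 c0] right_modular[of c2 c2 c0] right_modular[of c2 c3 c0]
      right_modular[of c3 c3 c0] right_modular[of c4 c3 c1]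
    by (simp_all only: t0 t1 t2)
  have less: "{..<5::nat} = {0, 1, 2, 3, 4}" by auto
  have "affine_hom (\<cdot>) (int 5) 2 (\<lambda>n. [c0, c1, c2, c3, c4] ! nat (n mod int 5))"
    by (rule affine_hom_nth) (auto simp: less t0 t1 t2 t3)
  then show ?thesis by (simp add: c)
qed

text \<open>Now \<open>a = 3\<close>: right multiplication by \<open>f\<close> runs through
  \<open>1, 3, 9, 5, 4, 1\<close>, and coordinate 0 is \<open>e((ef)e)\<close>. The table is filled
  in layers as for order 5.\<close>

lemma affine_hom_11:
  assumes "e = f \<cdot> ((f \<cdot> e) \<cdot> f)"
  shows "affine_hom (\<cdot>) 11 3
    (\<lambda>n. [e \<cdot> ((e \<cdot> f) \<cdot> e), e, (e \<cdot> f) \<cdot> (f \<cdot> e), e \<cdot> f, f \<cdot> (f \<cdot> e), (f \<cdot> e) \<cdot> f,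
      e \<cdot> (f \<cdot> (f \<cdot> e)), (e \<cdot> f) \<cdot> e, e \<cdot> (e \<cdot> f), f \<cdot> e, (f \<cdot> e) \<cdot> (e \<cdot> f)] ! nat (n mod 11))"
proof -
  define c0 c1 c2 c3 c4 c5 c6 c7 c8 c9 c10
    where c: "c0 = e \<cdot> ((e \<cdot> f) \<cdot> e)" "c1 = e" "c2 = (e \<cdot> f) \<cdot> (f \<cdot> e)" "c3 = e \<cdot> f"
      "c4 = f \<cdot> (f \<cdot> e)" "c5 = (f \<cdot> e) \<cdot> f" "c6 = e \<cdot> (f \<cdot> (f \<cdot> e))" "c7 = (e \<cdot> f) \<cdot> e"
      "c8 = e \<cdot> (e \<cdot> f)" "c9 = f \<cdot> e" "c10 = (f \<cdot> e) \<cdot> (e \<cdot> f)"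
  have right: "c1 \<cdot> f = c3" "c3 \<cdot> f = c9" "c9 \<cdot> f = c5" "c5 \<cdot> f = c4" "c4 \<cdot> f = c1"
    "c1 \<cdot> c3 = c8" "c3 \<cdot> c1 = c7" "c3 \<cdot> c9 = c2" "c9 \<cdot> c3 = c10" "c1 \<cdot> c4 = c6" "c1 \<cdot> c7 = c0"
    using assms by (simp_all add: c mult_mult_right flexible)
  then have left: "f \<cdot> c1 = c9" "f \<cdot> c3 = c5" "f \<cdot> c9 = c4" "f \<cdot> c5 = c1" "f \<cdot> c4 = c3"
    by (metis mult_mult_right)+
  note t0 = right left idem
  have t1: "c8 \<cdot> c3 = c7" "c6 \<cdot> f = c7" "c3 \<cdot> c4 = c1" "c7 \<cdot> c1 = c8"
      "c7 \<cdot> f = c10" "c2 \<cdot> c9 = c10" "c9 \<cdot> c1 = c3" "c9 \<cdot> c4 = c8"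
      "c1 \<cdot> c5 = c4" "c4 \<cdot> c9 = c5" "c10 \<cdot> c3 = c2" "c5 \<cdot> c1 = c2"
      "c5 \<cdot> c3 = c9"
    using right_modular[of c1 c3 c3] right_modular[of c1 c4 f] right_modular[of c1 f c4]
      right_modular[of c3 c1 c1] right_modular[of c3 c1 f] right_modular[of c3 c9 c9]
      right_modular[of c3 f c1] right_modular[of c3 f c4] right_modular[of c4 f c5]
      right_modular[of c5 f c9] right_modular[of c9 c3 c3] right_modular[of c9 f c1]
      right_modular[of c9 f c3]
    by (simp_all only: t0)
  have t2: "c1 \<cdot> c9 = c7" "c8 \<cdot> c5 = c3" "c8 \<cdot> f = c2" "c6 \<cdot> c3 = c1"
      "c4 \<cdot> c5 = c2" "c0 \<cdot> c7 = c8" "c3 \<cdot> c6 = c8" "c7 \<cdot> c9 = c3"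
      "c3 \<cdot> c5 = c10" "c2 \<cdot> c4 = c9" "c9 \<cdot> c7 = c2" "c4 \<cdot> c3 = c6"
      "c5 \<cdot> c9 = c8" "c2 \<cdot> c1 = c4" "c8 \<cdot> c1 = c0" "c10 \<cdot> c4 = c0"
      "c10 \<cdot> c6 = c7" "c10 \<cdot> c5 = c9" "c8 \<cdot> c4 = c5" "c5 \<cdot> c8 = c10"
    using right_modular[of c1 c1 c9] right_modular[of c1 c3 c5] right_modular[of c1 c3 f]
      right_modular[of c1 c4 c3] right_modular[of c1 c5 c5] right_modular[of c1 c7 c7]
      right_modular[of c1 f c6] right_modular[of c3 c1 c9] right_modular[of c3 c3 c5]
      right_modular[of c3 c9 c4] right_modular[of c3 f c7] right_modular[of c4 c4 c3]
      right_modular[of c4 c9 c9] right_modular[of c5 c1 c1] right_modular[of c7 c1 c1]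
      right_modular[of c7 f c4] right_modular[of c7 f c6] right_modular[of c9 c3 c5]
      right_modular[of c9 c4 c4] right_modular[of f c3 c8]
    by (simp_all only: t0 t1)
  have t3: "c8 \<cdot> c6 = c1" "c8 \<cdot> c10 = c4" "c6 \<cdot> c2 = c3" "c6 \<cdot> c8 = c2"
      "c6 \<cdot> c9 = c0" "c4 \<cdot> c8 = c7" "c4 \<cdot> c10 = c3" "c0 \<cdot> c9 = c4"
      "c7 \<cdot> c3 = c4" "c7 \<cdot> c4 = c2" "c7 \<cdot> c5 = c0" "c3 \<cdot> c8 = c4"
      "c7 \<cdot> c2 = c6" "c1 \<cdot> c2 = c10" "c1 \<cdot> c8 = c9" "c10 \<cdot> c1 = c6"
      "c10 \<cdot> c8 = c3" "c10 \<cdot> f = c8" "c2 \<cdot> c5 = c7" "c2 \<cdot> c7 = c3"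
      "c9 \<cdot> c5 = c6" "c6 \<cdot> c1 = c5" "c6 \<cdot> c5 = c8" "c6 \<cdot> c10 = c9"
      "c4 \<cdot> c2 = c8" "c2 \<cdot> c3 = c0" "c2 \<cdot> c8 = c1" "c2 \<cdot> c10 = c8"
      "c5 \<cdot> c2 = c0" "c5 \<cdot> c7 = c1" "c9 \<cdot> c6 = c4" "c8 \<cdot> c2 = c9"
      "c8 \<cdot> c7 = c10" "c4 \<cdot> c1 = c10" "c4 \<cdot> c7 = c9" "c3 \<cdot> c2 = c5"
      "c5 \<cdot> c4 = c7" "c5 \<cdot> c6 = c3" "c9 \<cdot> c2 = c1" "c1 \<cdot> c10 = c5"
    using right_modular[of c1 c3 c6] right_modular[of c1 c3 c10] right_modular[of c1 c4 c2]
      right_modular[of c1 c4 c8] right_modular[of c1 c4 c9] right_modular[of c1 c5 c8]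
      right_modular[of c1 c5 c10] right_modular[of c1 c7 c9] right_modular[of c1 c9 c3]
      right_modular[of c1 c9 c4] right_modular[of c1 c9 c5] right_modular[of c1 f c8]
      right_modular[of c3 c1 c2] right_modular[of c3 c4 c2] right_modular[of c3 c4 c8]
      right_modular[of c3 c5 c1] right_modular[of c3 c5 c8] right_modular[of c3 c5 f]
      right_modular[of c3 c9 c5] right_modular[of c3 c9 c7] right_modular[of c3 f c5]
      right_modular[of c4 c3 c1] right_modular[of c4 c3 c5] right_modular[of c4 c3 c10]
      right_modular[of c4 c4 c2] right_modular[of c4 c5 c3] right_modular[of c4 c5 c8]
      right_modular[of c4 c5 c10] right_modular[of c4 c9 c2] right_modular[of c4 c9 c7]
      right_modular[of c5 c3 c6] right_modular[of c5 c9 c2] right_modular[of c5 c9 c7]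
      right_modular[of c5 f c1] right_modular[of c5 f c7] right_modular[of c9 c1 c2]
      right_modular[of c9 f c4] right_modular[of c9 f c6] right_modular[of f c1 c2]
      right_modular[of f c5 c10]
    by (simp_all only: t0 t1 t2)
  have t4: "c4 \<cdot> c6 = c0" "c1 \<cdot> c6 = c2" "c10 \<cdot> c2 = c4" "c10 \<cdot> c7 = c5"
      "c10 \<cdot> c9 = c1" "c8 \<cdot> c9 = c6" "c6 \<cdot> c4 = c10" "c6 \<cdot> c7 = c4"
      "c0 \<cdot> c2 = c7" "c0 \<cdot> c4 = c3" "c0 \<cdot> c5 = c1" "c0 \<cdot> c8 = c6"
      "c9 \<cdot> c8 = c0" "c9 \<cdot> c10 = c7" "c7 \<cdot> c0 = c10" "c5 \<cdot> c10 = c6"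
      "c3 \<cdot> c7 = c6" "c3 \<cdot> c10 = c0" "c2 \<cdot> c6 = c5" "c0 \<cdot> c1 = c9"
      "c0 \<cdot> c3 = c5" "c0 \<cdot> c6 = c10" "c0 \<cdot> c10 = c2" "c7 \<cdot> c6 = c9"
      "c7 \<cdot> c8 = c5" "c7 \<cdot> c10 = c1" "c3 \<cdot> c0 = c9" "c10 \<cdot> c0 = c8"
      "c2 \<cdot> c0 = c6" "c9 \<cdot> c0 = c5" "c5 \<cdot> c0 = c4" "c1 \<cdot> c0 = c3"
      "c8 \<cdot> c0 = c2" "c4 \<cdot> c0 = c1"
    using right_modular[of c0 c9 c6] right_modular[of c1 c1 c6] right_modular[of c1 c2 c2]
      right_modular[of c1 c2 c7] right_modular[of c1 c2 c9] right_modular[of c1 c3 c9]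
      right_modular[of c1 c4 c4] right_modular[of c1 c4 c7] right_modular[of c1 c7 c2]
      right_modular[of c1 c7 c4] right_modular[of c1 c7 c5] right_modular[of c1 c7 c8]
      right_modular[of c1 c8 c8] right_modular[of c1 c8 c10] right_modular[of c1 c9 c0]
      right_modular[of c1 c10 c10] right_modular[of c1 f c7] right_modular[of c1 f c10]
      right_modular[of c2 c2 c6] right_modular[of c2 c3 c1] right_modular[of c2 c3 c3]
      right_modular[of c2 c3 c6] right_modular[of c2 c3 c10] right_modular[of c2 c5 c6]
      right_modular[of c2 c5 c8] right_modular[of c2 c5 c10] right_modular[of c2 c7 c0]
      right_modular[of c2 c9 c0] right_modular[of c3 c9 c0] right_modular[of c4 c7 c0]
      right_modular[of c4 c9 c0] right_modular[of c5 c7 c0] right_modular[of c5 c9 c0]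
      right_modular[of f c9 c0]
    by (simp_all only: t0 t1 t2 t3)
  have t5: "c6 \<cdot> c0 = c7"
    using right_modular[of c1 c4 c0]
    by (simp_all only: t0 t1 t2 t3 t4)
  have less: "{..<11::nat} = {0, 1, 2, 3, 4, 5, 6, 7, 8, 9, 10}"
    by (auto simp: lessThan_nat_numeral)
  have "affine_hom (\<cdot>) (int 11) 3
      (\<lambda>n. [c0, c1, c2, c3, c4, c5, c6, c7, c8, c9, c10] ! nat (n mod int 11))"
    by (rule affine_hom_nth) (auto simp: less t0 t1 t2 t3 t4 t5)
  then show ?thesis by (simp add: c)
qed

end

section \<open>From a groupoid on a carrier to a total operation\<close>

context W_groupoid
begin

text \<open>All points outside the carrier act as copies of \<open>f\<close>, which keeps the extended operation
  idempotent and right modular; so identities can be used without membership conditions.\<close>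

lemma total_extension:
  assumes "f \<in> carrier"
  obtains m where "idem_right_modular m"
    and "\<And>x y. x \<in> carrier \<Longrightarrow> y \<in> carrier \<Longrightarrow> m x y = x \<cdot> y"
proof -
  define r where "r x = (if x \<in> carrier then x else f)" for x
  \<comment> \<open>The diagonal is set apart because \<open>r x \<cdot> r x = r x\<close> differs
    from \<open>x\<close> off the carrier.\<close>
  define m where "m x y = (if x = y then x else r x \<cdot> r y)" for x y
  have r: "r x \<in> carrier" for x by (simp add: r_def assms)
  have m_left: "m x y = x \<cdot> r y" if "x \<in> carrier" for x y
    using that by (auto simp: m_def r_def idem)
  have m_neq: "m x y = r x \<cdot> r y" if "x \<noteq> y" for x y
    using that by (simp add: m_def)
  have m_same: "m x x = x" for x by (simp add: m_def)
  have twice: "(r x \<cdot> r y) \<cdot> r y = r y \<cdot> r x" for x y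
    using right_modular[of "r x" "r y" "r y"] by (simp add: idem r)
  have "m (m x y) z = m (m z y) x" for x y z
  proof -
    consider "x = z" | "x = y" "x \<noteq> z" | "z = y" "x \<noteq> z" | "x \<noteq> y" "z \<noteq> y" by blast
    then show ?thesis
    proof cases
      case 1 then show ?thesis by simp
    next
      case 2
      then show ?thesis
        using m_left[of "r z \<cdot> r x" x] by (simp add: m_same m_neq closed r twice)
    next
      case 3
      then show ?thesis
        using m_left[of "r x \<cdot> r z" z] by (simp add: m_same m_neq closed r twice)
    next
      case 4
      then show ?thesis
        using right_modular[of "r x" "r y" "r z"] by (simp add: m_neq m_left closed r)
    qed
  qed
  then have "idem_right_modular m"
    by unfold_locales (simp_all add: m_same)
  then show thesis
    by (rule that) (simp add: m_left r_def)
qed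

lemma affine_hom_restrict:
  assumes "affine_hom m p a \<phi>" and "\<And>n. \<phi> n \<in> carrier"
    and "\<And>x y. x \<in> carrier \<Longrightarrow> y \<in> carrier \<Longrightarrow> m x y = x \<cdot> y"
  shows "affine_hom (\<cdot>) p a \<phi>"
  using assms by (simp add: affine_hom_def)

end

section \<open>The equations \<open>e = fgf\<close>, \<open>e = f(fg)\<close> and
  \<open>e = g(gf)\<close> in a one-step groupoid\<close>

context one_step_W_groupoid
begin

text \<open>The distinct elements \<open>ef\<close> and \<open>fe\<close> both lie in the affine
  image over the residues mod 5, so it fills the carrier.\<close>

lemma equation_5:
  assumes "e \<in> carrier" "f \<in> carrier" "e \<cdot> f \<noteq> f \<cdot> e" "e = ((f \<cdot> e) \<cdot> f) \<cdot> f"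
  shows quasigroup_5: "quasigroup carrier (\<cdot>)"
    and cayley_5: "let ef = e \<cdot> f; fe = f \<cdot> e; fef = (f \<cdot> e) \<cdot> f in
          has_cayley_table carrier (\<cdot>) [e, f, ef, fe, fef]
            [[e,   ef,  f,   fef, fe],
             [fe,  f,   fef, e,   ef],
             [fef, fe,  ef,  f,   e],
             [ef,  fef, e,   fe,  f],
             [f,   e,   fe,  ef,  fef]]" (is ?table)
proof -
  obtain m where m: "idem_right_modular m"
    and m_eq: "\<And>x y. x \<in> carrier \<Longrightarrow> y \<in> carrier \<Longrightarrow> m x y = x \<cdot> y"
    using total_extension[OF \<open>f \<in> carrier\<close>] by blast
  note mem = closed \<open>e \<in> carrier\<close> \<open>f \<in> carrier\<close>
  let ?c = "[e \<cdot> (e \<cdot> f), e, e \<cdot> f, (f \<cdot> e) \<cdot> f, f \<cdot> e]"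
  define \<phi> where "\<phi> n = ?c ! nat (n mod 5)" for n :: int
  have "\<phi> n \<in> set ?c" for n
    unfolding \<phi>_def by (rule nth_mem) (simp add: nat_less_iff)
  moreover have "set ?c \<subseteq> carrier" by (simp add: mem)
  ultimately have in_carrier: "\<phi> n \<in> carrier" for n by blast
  have "affine_hom m 5 2 \<phi>"
    using idem_right_modular.affine_hom_5[OF m, of e f] assms(4)
    by (simp add: \<phi>_def[abs_def] m_eq mem)
  then have hom: "affine_hom (\<cdot>) 5 2 \<phi>"
    using in_carrier m_eq by (rule affine_hom_restrict)
  have val: "\<phi> 1 = e" "\<phi> 2 = e \<cdot> f" "\<phi> 4 = f \<cdot> e" "\<phi> 3 = (f \<cdot> e) \<cdot> f"
    by (simp_all add: \<phi>_def)
  have neq: "\<phi> 2 \<noteq> \<phi> 4" using assms(3) val by simp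
  have range: "range \<phi> \<subseteq> carrier" using in_carrier by blast
  have "prime (5::int)" "\<not> (5::int) dvd 2" "\<not> (5::int) dvd 1 - 2"
    "\<not> (5::int) dvd 2 * 2 - 1" by simp_all
  note bij = affine_hom_bij[OF hom range this neq]
  show "quasigroup carrier (\<cdot>)" by (rule bij(3))
  \<comment> \<open>Lying in the image, \<open>f\<close> has a coordinate \<open>k\<close>; the
    product \<open>ef\<close> forces \<open>2 - k = 2\<close>, so \<open>k = 0\<close>.\<close>
  have "f \<in> range \<phi>"
    using bij(1) \<open>f \<in> carrier\<close> by blast
  then obtain k where k: "f = \<phi> k" by blast
  have "\<phi> 1 \<cdot> \<phi> k = \<phi> 2" using val k by simp
  then have "\<phi> (2 - k) = \<phi> 2"
    by (simp add: affine_hom_mult[OF hom])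
  then have "[2 - k = 2] (mod 5)" using bij(2) by blast
  then have "[k = 0] (mod 5)" by (simp add: cong_iff_dvd_diff)
  then have f: "\<phi> 0 = f" using k affine_hom_cong[OF hom] by simp
  have ks: "set [1, 0, 2, 4, 3] = {0..<5::int}" by auto
  have "has_cayley_table carrier (\<cdot>) (map \<phi> [1, 0, 2, 4, 3])
        (map (\<lambda>x. map (\<lambda>y. \<phi> ((2 * x + (1 - 2) * y) mod 5)) [1, 0, 2, 4, 3]) [1, 0, 2, 4, 3])"
    by (rule bij(4)[OF _ ks]) simp
  then show ?table by (simp add: val f)
qed

lemma equation_11:
  assumes "e \<in> carrier" "f \<in> carrier" "e \<cdot> f \<noteq> f \<cdot> e" "e = f \<cdot> ((f \<cdot> e) \<cdot> f)"
  shows quasigroup_11: "quasigroup carrier (\<cdot>)"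
    and cayley_11: "let xs = [e, e \<cdot> f, f \<cdot> e, (f \<cdot> e) \<cdot> f, f \<cdot> (f \<cdot> e), e \<cdot> (e \<cdot> f), (e \<cdot> f) \<cdot> e,
                   (e \<cdot> f) \<cdot> (f \<cdot> e), (f \<cdot> e) \<cdot> (e \<cdot> f), e \<cdot> (f \<cdot> (f \<cdot> e)), e \<cdot> ((e \<cdot> f) \<cdot> e)] in
          has_cayley_table carrier (\<cdot>) xs (labelled xs
            [[1, 6, 7, 5, 10, 3, 11, 9, 4, 8, 2],
             [7, 2, 8, 9, 1, 5, 10, 4, 11, 6, 3],
             [2, 9, 3, 10, 6, 11, 8, 1, 7, 5, 4],
             [8, 3, 6, 4, 7, 9, 1, 11, 10, 2, 5],
             [9, 10, 4, 8, 5, 7, 3, 6, 2, 11, 1],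
             [11, 7, 10, 2, 4, 6, 9, 3, 5, 1, 8],
             [6, 5, 2, 11, 8, 4, 7, 10, 1, 3, 9],
             [5, 11, 9, 7, 3, 1, 2, 8, 6, 4, 10],
             [10, 8, 1, 3, 11, 2, 4, 5, 9, 7, 6],
             [4, 1, 11, 6, 9, 8, 5, 2, 3, 10, 7],
             [3, 4, 5, 1, 2, 10, 6, 7, 8, 9, 11]])" (is "let xs = ?xs in ?table xs")
proof -
  obtain m where m: "idem_right_modular m"
    and m_eq: "\<And>x y. x \<in> carrier \<Longrightarrow> y \<in> carrier \<Longrightarrow> m x y = x \<cdot> y"
    using total_extension[OF \<open>f \<in> carrier\<close>] by blast
  note mem = closed \<open>e \<in> carrier\<close> \<open>f \<in> carrier\<close>
  let ?c = "[e \<cdot> ((e \<cdot> f) \<cdot> e), e, (e \<cdot> f) \<cdot> (f \<cdot> e), e \<cdot> f, f \<cdot> (f \<cdot> e), (f \<cdot> e) \<cdot> f,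
      e \<cdot> (f \<cdot> (f \<cdot> e)), (e \<cdot> f) \<cdot> e, e \<cdot> (e \<cdot> f), f \<cdot> e, (f \<cdot> e) \<cdot> (e \<cdot> f)]"
  define \<phi> where "\<phi> n = ?c ! nat (n mod 11)" for n :: int
  have "\<phi> n \<in> set ?c" for n
    unfolding \<phi>_def by (rule nth_mem) (simp add: nat_less_iff)
  moreover have "set ?c \<subseteq> carrier" by (simp add: mem)
  ultimately have in_carrier: "\<phi> n \<in> carrier" for n by blast
  have "affine_hom m 11 3 \<phi>"
    using idem_right_modular.affine_hom_11[OF m, of e f] assms(4)
    by (simp add: \<phi>_def[abs_def] m_eq mem)
  then have hom: "affine_hom (\<cdot>) 11 3 \<phi>"
    using in_carrier m_eq by (rule affine_hom_restrict)
  have neq: "\<phi> 3 \<noteq> \<phi> 9" using assms(3) by (simp add: \<phi>_def)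
  have range: "range \<phi> \<subseteq> carrier" using in_carrier by blast
  have "prime (11::int)" "\<not> (11::int) dvd 3" "\<not> (11::int) dvd 1 - 3"
    "\<not> (11::int) dvd 2 * 3 - 1" by simp_all
  note bij = affine_hom_bij[OF hom range this neq]
  show "quasigroup carrier (\<cdot>)" by (rule bij(3))
  \<comment> \<open>The affine coordinates of the labels, in the order of the table.\<close>
  let ?ks = "[1, 3, 9, 5, 4, 8, 7, 2, 10, 6, 0] :: int list"
  have "set ?ks = {0..<11}" by auto presburger
  then have "has_cayley_table carrier (\<cdot>) (map \<phi> ?ks)
        (map (\<lambda>x. map (\<lambda>y. \<phi> ((3 * x + (1 - 3) * y) mod 11)) ?ks) ?ks)"
    by (intro bij(4)) simp
  then have "?table (map \<phi> ?ks)" by (simp add: labelled_def)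
  moreover have "map \<phi> ?ks = ?xs" by (simp add: \<phi>_def)
  ultimately show "let xs = ?xs in ?table xs" by (simp only: Let_def)
qed

text \<open>The elements \<open>e\<close> and \<open>y = f(fe)\<close> generate at most four
  elements. Either they commute, which gives \<open>e = fgf\<close>, or these four are the whole
  carrier and \<open>f\<close> is among them.\<close>

lemma equation_ggf:
  assumes "e \<in> carrier" "f \<in> carrier" "e = (e \<cdot> f) \<cdot> (f \<cdot> e)"
  shows "e = ((f \<cdot> e) \<cdot> f) \<cdot> f \<or> e = (f \<cdot> e) \<cdot> f"
proof -
  obtain m where "idem_right_modular m"
    and m_eq: "\<And>x y. x \<in> carrier \<Longrightarrow> y \<in> carrier \<Longrightarrow> m x y = x \<cdot> y"
    using total_extension[OF \<open>f \<in> carrier\<close>] by blast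
  then interpret T: idem_right_modular m by simp
  note mem = closed \<open>e \<in> carrier\<close> \<open>f \<in> carrier\<close>
  define y where "y = f \<cdot> (f \<cdot> e)"
  define u where "u = e \<cdot> y"
  define v where "v = y \<cdot> e"
  have mem': "y \<in> carrier" "u \<in> carrier" "v \<in> carrier"
    by (simp_all add: y_def u_def v_def mem)
  have y: "e = m (m e f) (m f e)" "y = m f (m f e)"
    using assms(3) by (simp_all add: y_def m_eq mem)
  show ?thesis
  proof (cases "u = v")
    case True
    then have "m e y = m y e" by (simp add: u_def v_def m_eq mem mem')
    then show ?thesis
      using T.ggf_imp_fgf_if_commute[OF y] by (simp add: m_eq mem)
  next
    case False
    have "u = m e y" "v = m y e" by (simp_all add: u_def v_def m_eq mem mem')
    note table = T.quaternary_table[OF T.ggf_imp_quaternary[OF y] this]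
    have table: "e \<cdot> y = u" "y \<cdot> e = v" "e \<cdot> u = v" "e \<cdot> v = y" "y \<cdot> u = e" "y \<cdot> v = u" "u \<cdot> e = y"
      "u \<cdot> y = v" "u \<cdot> v = e" "v \<cdot> e = u" "v \<cdot> y = e" "v \<cdot> u = y"
      using table by (simp_all add: u_def[symmetric] v_def[symmetric] m_eq mem mem')
    have "subgroupoid {e, y, u, v} carrier (\<cdot>)"
      unfolding subgroupoid_def groupoid_def by (auto simp: table mem mem' idem)
    moreover have "\<not> commutative_on {e, y, u, v} (\<cdot>)"
      using False table(1,2) by (auto simp: commutative_on_def)
    ultimately have "{e, y, u, v} = carrier"
      using proper_commutative by blast
    with \<open>f \<in> carrier\<close> have "f = e \<or> f = y \<or> f = u \<or> f = v" by blast
    \<comment> \<open>Over the field of order 4, \<open>(xe)x = 2a^2 x + a^3 e = e\<close> for every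
      \<open>x\<close>.\<close>
    then have "(f \<cdot> e) \<cdot> f = e" by (auto simp: table mem idem)
    then show ?thesis by simp
  qed
qed

section \<open>Words in \<open>f\<close> and \<open>ef\<close>\<close>

text \<open>The word values form a subgroupoid containing the noncommuting pair \<open>f\<close>,
  \<open>ef\<close>. So every norm is the minimum of a nonempty set.\<close>

lemma word_value_surj:
  assumes "e \<in> carrier" "f \<in> carrier" "e \<cdot> f \<noteq> f \<cdot> e"
  shows "range (word_value (\<cdot>) e f) = carrier"
proof -
  obtain m where "idem_right_modular m"
    and m_eq: "\<And>x y. x \<in> carrier \<Longrightarrow> y \<in> carrier \<Longrightarrow> m x y = x \<cdot> y"
    using total_extension[OF \<open>f \<in> carrier\<close>] by blast
  then interpret T: idem_right_modular m by simp
  note mem = closed \<open>e \<in> carrier\<close> \<open>f \<in> carrier\<close>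
  have "word_value (\<cdot>) e f w \<in> carrier" for w
    by (induction w) (simp_all add: mem)
  moreover have "word_value (\<cdot>) e f w \<cdot> word_value (\<cdot>) e f w' \<in> range (word_value (\<cdot>) e f)" for w w'
    by (rule range_eqI[of _ _ "Prod w w'"]) simp
  ultimately have "subgroupoid (range (word_value (\<cdot>) e f)) carrier (\<cdot>)"
    by (auto simp: subgroupoid_def groupoid_def)
  moreover have "f \<cdot> (e \<cdot> f) \<noteq> (e \<cdot> f) \<cdot> f"
    using T.commute_if_fef_eq_fe[of f e] T.flexible[of f e] T.mult_mult_right[of e f] assms(3)
    by (auto simp: m_eq mem)
  then have "\<not> commutative_on (range (word_value (\<cdot>) e f)) (\<cdot>)"
    unfolding commutative_on_def by (metis rangeI word_value.simps(1,2))
  ultimately show ?thesis using proper_commutative by blast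
qed

end

lemma word_length_pos: "0 < word_length w"
  by (induction w) simp_all

lemma word_length_eq_1: "word_length w = 1 \<longleftrightarrow> w \<in> {F, EF}"
proof (cases w)
  case (Prod u v)
  then show ?thesis using word_length_pos[of u] word_length_pos[of v] by simp
qed simp_all

lemma word_length_eq_2:
  assumes "word_length w = 2"
  shows "\<exists>u\<in>{F, EF}. \<exists>v\<in>{F, EF}. w = Prod u v"
proof (cases w)
  case (Prod u v)
  with assms have "word_length u + word_length v = 2" by simp
  with word_length_pos[of u] word_length_pos[of v] have "word_length u = 1" "word_length v = 1"
    by linarith+
  with Prod show ?thesis using word_length_eq_1 by blast
qed (use assms in simp_all)

lemma word_length_eq_3:
  assumes "word_length w = 3"
  shows "\<exists>u\<in>{F, EF}. \<exists>v\<in>{F, EF}. \<exists>x\<in>{F, EF}. w = Prod u (Prod v x) \<or> w = Prod (Prod u v) x"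
proof (cases w)
  case (Prod u v)
  with assms have "word_length u + word_length v = 3" by simp
  with word_length_pos[of u] word_length_pos[of v]
  consider "word_length u = 1" "word_length v = 2" | "word_length u = 2" "word_length v = 1"
    by linarith
  then show ?thesis
    using Prod word_length_eq_1 word_length_eq_2 by cases blast+
qed (use assms in simp_all)

section \<open>The words of length three that can represent \<open>e\<close>\<close>

context one_step_W_groupoid
begin

text \<open>Two bracketings of three letters give sixteen words; all but those equal to
  \<open>f(fg)\<close>, \<open>fgf\<close>, \<open>gfg\<close> or \<open>g(gf)\<close> reduce to
  shorter ones, which the norm excludes.\<close>

lemma norm_3_cases:
  assumes "e \<in> carrier" "f \<in> carrier" "e \<cdot> f \<noteq> f \<cdot> e" "word_norm (\<cdot>) e f e = 3"
  shows "e = ((f \<cdot> e) \<cdot> f) \<cdot> f \<or> e = f \<cdot> ((f \<cdot> e) \<cdot> f)"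
proof -
  obtain m where "idem_right_modular m"
    and m_eq: "\<And>x y. x \<in> carrier \<Longrightarrow> y \<in> carrier \<Longrightarrow> m x y = x \<cdot> y"
    using total_extension[OF \<open>f \<in> carrier\<close>] by blast
  then interpret T: idem_right_modular m by simp
  note mem = closed \<open>e \<in> carrier\<close> \<open>f \<in> carrier\<close>
  have twice: "(x \<cdot> y) \<cdot> y = y \<cdot> x" and flex: "x \<cdot> (y \<cdot> x) = (x \<cdot> y) \<cdot> x"
    if "x \<in> carrier" "y \<in> carrier" for x y
    using T.mult_mult_right[of x y] T.flexible[of x y] that by (simp_all add: m_eq closed)
  have shorter: "word_value (\<cdot>) e f w \<noteq> e" if "word_length w < 3" for w
    using that assms(4)
      not_less_Least[of "word_length w" "\<lambda>n. \<exists>w. word_value (\<cdot>) e f w = e \<and> word_length w = n"]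
    unfolding word_norm_def by auto
  have "\<exists>w. word_value (\<cdot>) e f w = e"
    using word_value_surj[OF assms(1-3)] assms(1) by (metis rangeE)
  then have "\<exists>w. word_value (\<cdot>) e f w = e \<and> word_length w = 3"
    using LeastI_ex[of "\<lambda>n. \<exists>w. word_value (\<cdot>) e f w = e \<and> word_length w = n"] assms(4)
    unfolding word_norm_def by auto
  then obtain w where w: "word_value (\<cdot>) e f w = e" "word_length w = 3" by blast
  \<comment> \<open>These are the words \<open>f\<close>, \<open>g\<close>, \<open>gf\<close> and
    \<open>fg\<close>.\<close>
  have short: "f \<noteq> e" "e \<cdot> f \<noteq> e" "f \<cdot> e \<noteq> e" "(f \<cdot> e) \<cdot> f \<noteq> e"
    using shorter[of F] shorter[of EF] shorter[of "Prod EF F"] shorter[of "Prod F EF"]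
    by (simp_all add: twice flex mem)
  \<comment> \<open>In words: \<open>(fg)g = gf\<close>, which is shorter, and
    \<open>g(fg) = (gf)g\<close>.\<close>
  have "((f \<cdot> e) \<cdot> f) \<cdot> (e \<cdot> f) = f \<cdot> e" "(e \<cdot> f) \<cdot> ((f \<cdot> e) \<cdot> f) = (f \<cdot> e) \<cdot> (e \<cdot> f)"
    using twice[of f "e \<cdot> f"] flex[of "e \<cdot> f" f] by (simp_all add: twice flex mem)
  with word_length_eq_3[OF w(2)] w(1) short
  consider "e = ((f \<cdot> e) \<cdot> f) \<cdot> f" | "e = f \<cdot> ((f \<cdot> e) \<cdot> f)"
    | "e = (f \<cdot> e) \<cdot> (e \<cdot> f)" | "e = (e \<cdot> f) \<cdot> (f \<cdot> e)"
    by (auto simp: twice flex idem mem)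
  then show ?thesis
  proof cases
    case 3
    then show ?thesis using T.gfg_imp_fgf[of e f] by (simp add: m_eq mem)
  next
    case 4
    then show ?thesis using equation_ggf[OF assms(1,2)] short by metis
  qed blast+
qed

end

theorem theorem18:
  fixes G :: "'a set" and mult :: "'a \<Rightarrow> 'a \<Rightarrow> 'a" (infixl "\<cdot>" 70) and e f :: 'a
  assumes "one_step_W_groupoid G (\<cdot>)"
    and "e \<in> G" and "f \<in> G" and "e \<noteq> f" and "e \<cdot> f \<noteq> f \<cdot> e"
    and "G = generated_subgroupoid G (\<cdot>) {e, f}"
    and "word_norm (\<cdot>) e f e = 3"
  shows "quasigroup G (\<cdot>)
    \<and> (e = ((f \<cdot> e) \<cdot> f) \<cdot> f \<or> e = f \<cdot> ((f \<cdot> e) \<cdot> f))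
    \<and> (e = ((f \<cdot> e) \<cdot> f) \<cdot> f \<longrightarrow>
        (let ef = e \<cdot> f; fe = f \<cdot> e; fef = (f \<cdot> e) \<cdot> f in
          has_cayley_table G (\<cdot>) [e, f, ef, fe, fef]
            [[e,   ef,  f,   fef, fe],
             [fe,  f,   fef, e,   ef],
             [fef, fe,  ef,  f,   e],
             [ef,  fef, e,   fe,  f],
             [f,   e,   fe,  ef,  fef]]))
    \<and> (e = f \<cdot> ((f \<cdot> e) \<cdot> f) \<longrightarrow>
        (let xs = [e, e \<cdot> f, f \<cdot> e, (f \<cdot> e) \<cdot> f, f \<cdot> (f \<cdot> e), e \<cdot> (e \<cdot> f), (e \<cdot> f) \<cdot> e,
                   (e \<cdot> f) \<cdot> (f \<cdot> e), (f \<cdot> e) \<cdot> (e \<cdot> f), e \<cdot> (f \<cdot> (f \<cdot> e)), e \<cdot> ((e \<cdot> f) \<cdot> e)] in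
          has_cayley_table G (\<cdot>) xs (labelled xs
            [[1, 6, 7, 5, 10, 3, 11, 9, 4, 8, 2],
             [7, 2, 8, 9, 1, 5, 10, 4, 11, 6, 3],
             [2, 9, 3, 10, 6, 11, 8, 1, 7, 5, 4],
             [8, 3, 6, 4, 7, 9, 1, 11, 10, 2, 5],
             [9, 10, 4, 8, 5, 7, 3, 6, 2, 11, 1],
             [11, 7, 10, 2, 4, 6, 9, 3, 5, 1, 8],
             [6, 5, 2, 11, 8, 4, 7, 10, 1, 3, 9],
             [5, 11, 9, 7, 3, 1, 2, 8, 6, 4, 10],
             [10, 8, 1, 3, 11, 2, 4, 5, 9, 7, 6],
             [4, 1, 11, 6, 9, 8, 5, 2, 3, 10, 7],
             [3, 4, 5, 1, 2, 10, 6, 7, 8, 9, 11]])))"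
proof -
  interpret one_step_W_groupoid G "(\<cdot>)" by (fact assms(1))
  show ?thesis
    using norm_3_cases quasigroup_5 quasigroup_11 cayley_5 cayley_11 assms(2,3,5,7) by blast
qed

end
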